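(* Let $G$ be a bipartite graph without isolated vertices. Then $\chi'_{sCF}(G)\le 2$ and $\chi'_{CF}(G)\le 3$.
   Context: All graphs are finite and simple. For a graph $G$ and a vertex $v$, $E_G(v)$ denotes the set of edges of $G$ incident with $v$, and for an edge $uv\in E(G)$ its closed neighborhood is $E_G[uv]:=E_G(u)\cup E_G(v)$ (this contains $uv$ itself). An edge $k$-coloring of a graph is any assignment of colors from $\{1,\dots,k\}$ to its edges (not necessarily proper). Given an edge coloring $\varphi$ of a subgraph $H$ of $G$ (that is, a partial edge coloring of $G$, coloring exactly the edges in $E(H)$), an edge $uv\in E(G)$ is satisfied by $\varphi$ if there is a color that appears exactly once (that is, on exactly one edge) in $E_G[uv]\cap E(H)$. An edge coloring of all of $G$ is conflict-free if every edge of $G$ is satisfied (case $H=G$). The conflict-free chromatic index $\chi'_{CF}(G)$ is the least number of colors in a conflict-free edge coloring of $G$. The parameter $\chi'_{sCF}(G)$ is the least number of colors required for coloring the edges of some subgraph $H$ of $G$ such that all edges of $G$ (colored or not) are satisfied. *)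

theory Defs
  imports Main
begin

text \<open>A graph is given by its vertex set \<open>V\<close> and its edge set \<open>E\<close>, an edge being the
  two-element set of its ends; so graphs are undirected, loopless and without multiple edges.\<close>

definition simple_graph :: "'a set \<Rightarrow> 'a set set \<Rightarrow> bool" where
  "simple_graph V E \<longleftrightarrow> finite V \<and> (\<forall>e\<in>E. e \<subseteq> V \<and> card e = 2)"

definition subgraph :: "'a set \<Rightarrow> 'a set set \<Rightarrow> 'a set \<Rightarrow> 'a set set \<Rightarrow> bool" where
  "subgraph W F V E \<longleftrightarrow> simple_graph W F \<and> W \<subseteq> V \<and> F \<subseteq> E"

definition incident_edges :: "'a set set \<Rightarrow> 'a \<Rightarrow> 'a set set" where
  "incident_edges E v = {e\<in>E. v \<in> e}"

definition isolated_vertex :: "'a set \<Rightarrow> 'a set set \<Rightarrow> 'a \<Rightarrow> bool" where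
  "isolated_vertex V E v \<longleftrightarrow> v \<in> V \<and> incident_edges E v = {}"

definition bipartite :: "'a set \<Rightarrow> 'a set set \<Rightarrow> bool" where
  "bipartite V E \<longleftrightarrow>
     (\<exists>A B. A \<union> B = V \<and> A \<inter> B = {} \<and> (\<forall>e\<in>E. \<exists>a\<in>A. \<exists>b\<in>B. e = {a, b}))"

definition closed_edge_nbhd :: "'a set set \<Rightarrow> 'a set \<Rightarrow> 'a set set" where
  "closed_edge_nbhd E e = (\<Union>v\<in>e. incident_edges E v)"

lemma closed_edge_nbhd_pair:
  "closed_edge_nbhd E {u, v} = incident_edges E u \<union> incident_edges E v"
  by (simp add: closed_edge_nbhd_def)

text \<open>A colouring of the edges of a subgraph with edge set \<open>F\<close> is a total function on edges of
  which only the values on \<open>F\<close> are used: edges outside \<open>F\<close> are uncoloured.\<close>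

definition edge_coloring :: "nat \<Rightarrow> 'a set set \<Rightarrow> ('a set \<Rightarrow> nat) \<Rightarrow> bool" where
  "edge_coloring k F \<phi> \<longleftrightarrow> (\<forall>e\<in>F. \<phi> e \<in> {1..k})"

definition satisfied :: "'a set set \<Rightarrow> 'a set set \<Rightarrow> ('a set \<Rightarrow> nat) \<Rightarrow> 'a set \<Rightarrow> bool" where
  "satisfied E F \<phi> e \<longleftrightarrow> (\<exists>c. \<exists>!f. f \<in> closed_edge_nbhd E e \<inter> F \<and> \<phi> f = c)"

definition conflict_free :: "nat \<Rightarrow> 'a set set \<Rightarrow> ('a set \<Rightarrow> nat) \<Rightarrow> bool" where
  "conflict_free k E \<phi> \<longleftrightarrow> edge_coloring k E \<phi> \<and> (\<forall>e\<in>E. satisfied E E \<phi> e)"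

definition chi_CF :: "'a set \<Rightarrow> 'a set set \<Rightarrow> nat" where
  "chi_CF V E = (LEAST k. \<exists>\<phi>. conflict_free k E \<phi>)"

definition chi_sCF :: "'a set \<Rightarrow> 'a set set \<Rightarrow> nat" where
  "chi_sCF V E = (LEAST k. \<exists>W F \<phi>. subgraph W F V E \<and> edge_coloring k F \<phi> \<and>
     (\<forall>e\<in>E. satisfied E F \<phi> e))"

text \<open>Giving all edges distinct colours shows that both minima are attained, so that the two
  parameters above are meaningful for every graph.\<close>

lemma ex_conflict_free:
  assumes "simple_graph V E"
  shows "\<exists>k \<phi>. conflict_free k E \<phi>"
proof -
  have "E \<subseteq> Pow V" "finite V" using assms by (auto simp: simple_graph_def)
  then have "finite E" by (meson finite_Pow_iff finite_subset)
  then obtain g :: "'a set \<Rightarrow> nat" and n where g: "g ` E = {i. i < n}" "inj_on g E"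
    using finite_imp_inj_to_nat_seg by blast
  have "satisfied E E (Suc \<circ> g) e" if "e \<in> E" for e
  proof -
    from that assms have "e \<noteq> {}" by (auto simp: simple_graph_def)
    with that have "e \<in> closed_edge_nbhd E e"
      by (auto simp: closed_edge_nbhd_def incident_edges_def)
    with that g(2) have "\<exists>!f. f \<in> closed_edge_nbhd E e \<inter> E \<and> (Suc \<circ> g) f = Suc (g e)"
      by (intro ex1I[of _ e]) (auto dest: inj_onD)
    then show ?thesis unfolding satisfied_def by blast
  qed
  moreover have "edge_coloring n E (Suc \<circ> g)"
    unfolding edge_coloring_def
  proof
    fix e assume "e \<in> E"
    then have "g e \<in> {i. i < n}" using g(1) by blast
    then show "(Suc \<circ> g) e \<in> {1..n}" by simp
  qed
  ultimately show ?thesis unfolding conflict_free_def by blast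
qed

lemma ex_conflict_free_subgraph:
  assumes "simple_graph V E"
  shows "\<exists>k W F \<phi>. subgraph W F V E \<and> edge_coloring k F \<phi> \<and> (\<forall>e\<in>E. satisfied E F \<phi> e)"
  using ex_conflict_free[OF assms] assms
  unfolding conflict_free_def subgraph_def by blast

end

theory Submission
  imports Defs
begin

text \<open>Let \<open>A\<close> and \<open>B\<close> be the two sides, and let \<open>S \<subseteq> A\<close> be a minimal set that contains a
  neighbour of every vertex of \<open>B\<close>. By minimality every \<open>a \<in> S\<close> has a private neighbour
  \<open>p a \<in> B\<close>, one whose only neighbour in \<open>S\<close> is \<open>a\<close> (\<open>minimal_cover_with_private_elements\<close>).
  Every \<open>b \<in> B\<close> chooses a neighbour \<open>q b \<in> S\<close>, and \<open>H\<close> consists of the edges \<open>q b b\<close>; this is a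
  star forest whose leaves are the vertices of \<open>B\<close>, and it contains the edges \<open>a p a\<close>, because
  \<open>q (p a) = a\<close>. Colour the edges \<open>a p a\<close> with 2 and the other edges of \<open>H\<close> with 1.

  An edge \<open>ab\<close> of \<open>G\<close> with \<open>a \<in> A - S\<close> sees only one edge of \<open>H\<close>, namely \<open>q b b\<close>. An edge \<open>ab\<close>
  with \<open>a \<in> S\<close> sees \<open>a p a\<close> and no other edge of colour 2: if \<open>b\<close> lies on an edge of colour 2,
  then \<open>b\<close> is the private neighbour of some vertex of \<open>S\<close>, and since \<open>a\<close> is adjacent to \<open>b\<close>, that
  vertex is \<open>a\<close>. So two colours suffice when edges may stay uncoloured
  (\<open>bipartite_two_colorable_subgraph\<close>). For a colouring of all edges, give the uncoloured edges a
  third colour (\<open>conflict_free_of_subgraph_coloring\<close>).\<close>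

lemma simple_graph_edge_subset:
  assumes "simple_graph V E" and "F \<subseteq> E"
  shows "simple_graph V F"
  using assms by (auto simp: simple_graph_def)

text \<open>If some \<open>a\<close> in a minimal cover had no private element, the cover without \<open>a\<close> would still
  be one.\<close>

lemma minimal_cover_with_private_elements:
  assumes "finite A" and "\<forall>b\<in>B. \<exists>a\<in>A. R a b"
  obtains S where "S \<subseteq> A" and "\<forall>b\<in>B. \<exists>a\<in>S. R a b"
    and "\<forall>a\<in>S. \<exists>b\<in>B. R a b \<and> (\<forall>a'\<in>S. R a' b \<longrightarrow> a' = a)"
proof -
  let ?covers = "{S. S \<subseteq> A \<and> (\<forall>b\<in>B. \<exists>a\<in>S. R a b)}"
  have "finite ?covers" using assms(1) by simp
  moreover have "A \<in> ?covers" using assms(2) by blast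
  ultimately obtain S where S: "S \<in> ?covers" and min: "\<forall>T\<in>?covers. T \<subseteq> S \<longrightarrow> S = T"
    using finite_has_minimal[of ?covers] by blast
  have "\<exists>b\<in>B. R a b \<and> (\<forall>a'\<in>S. R a' b \<longrightarrow> a' = a)" if "a \<in> S" for a
  proof (rule ccontr)
    assume no_private: "\<not> ?thesis"
    have "S - {a} \<in> ?covers" using S no_private by blast
    then show False using min that by blast
  qed
  with S show thesis using that by blast
qed

lemma satisfiedI:
  assumes "f \<in> E" "f \<in> F" "f \<inter> e \<noteq> {}"
    and "\<And>g. g \<in> F \<Longrightarrow> g \<inter> e \<noteq> {} \<Longrightarrow> \<phi> g = \<phi> f \<Longrightarrow> g = f"
  shows "satisfied E F \<phi> e"
proof -
  have "\<exists>!g. g \<in> closed_edge_nbhd E e \<inter> F \<and> \<phi> g = \<phi> f"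
    using assms by (intro ex1I[of _ f]) (auto simp: closed_edge_nbhd_def incident_edges_def)
  then show ?thesis unfolding satisfied_def by blast
qed

lemma bipartite_two_colorable_subgraph:
  assumes "simple_graph V E" and "bipartite V E" and "\<forall>v\<in>V. \<not> isolated_vertex V E v"
  obtains F \<phi> where "F \<subseteq> E" and "edge_coloring 2 F \<phi>" and "\<forall>e\<in>E. satisfied E F \<phi> e"
proof -
  obtain A B where sides: "A \<union> B = V" "A \<inter> B = {}"
    and edges: "\<forall>e\<in>E. \<exists>a\<in>A. \<exists>b\<in>B. e = {a, b}"
    using assms(2) unfolding bipartite_def by blast
  have "finite A" using assms(1) sides(1) by (auto simp: simple_graph_def)
  moreover have "\<forall>b\<in>B. \<exists>a\<in>A. {a, b} \<in> E"
  proof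
    fix b assume b: "b \<in> B"
    then obtain e where e: "e \<in> E" "b \<in> e"
      using assms(3) sides(1) by (auto simp: isolated_vertex_def incident_edges_def)
    then obtain a b' where "a \<in> A" "b' \<in> B" "e = {a, b'}" using edges by blast
    with e b sides(2) show "\<exists>a\<in>A. {a, b} \<in> E" by auto
  qed
  ultimately obtain S where S: "S \<subseteq> A" "\<forall>b\<in>B. \<exists>a\<in>S. {a, b} \<in> E"
    and "\<forall>a\<in>S. \<exists>b\<in>B. {a, b} \<in> E \<and> (\<forall>a'\<in>S. {a', b} \<in> E \<longrightarrow> a' = a)"
    by (rule minimal_cover_with_private_elements[where R = "\<lambda>a b. {a, b} \<in> E"])
  then obtain p where p: "\<And>a. a \<in> S \<Longrightarrow> p a \<in> B" "\<And>a. a \<in> S \<Longrightarrow> {a, p a} \<in> E"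
    and priv: "\<And>a a'. a \<in> S \<Longrightarrow> a' \<in> S \<Longrightarrow> {a', p a} \<in> E \<Longrightarrow> a' = a"
    by metis
  obtain q where q: "\<And>b. b \<in> B \<Longrightarrow> q b \<in> S" "\<And>b. b \<in> B \<Longrightarrow> {q b, b} \<in> E"
    using S(2) by metis
  have q_p: "q (p a) = a" if "a \<in> S" for a
    using that p q priv by blast
  define F where "F = (\<lambda>b. {q b, b}) ` B"
  define P where "P = (\<lambda>a. {a, p a}) ` S"
  define \<phi> :: "'a set \<Rightarrow> nat" where "\<phi> e = (if e \<in> P then 2 else 1)" for e
  have "F \<subseteq> E" using q(2) by (auto simp: F_def)
  moreover have "edge_coloring 2 F \<phi>" by (auto simp: edge_coloring_def \<phi>_def)
  moreover have "satisfied E F \<phi> e" if e: "e \<in> E" for e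
  proof -
    obtain a b where ab: "a \<in> A" "b \<in> B" "e = {a, b}" using edges e by blast
    show ?thesis
    proof (cases "a \<in> S")
      case False
      have "g = {q b, b}" if g: "g \<in> F" "g \<inter> e \<noteq> {}" for g
      proof -
        obtain b' where b': "b' \<in> B" "g = {q b', b'}" using g(1) by (auto simp: F_def)
        \<comment> \<open>The centre \<open>q b'\<close> lies in \<open>S\<close>, so it is neither \<open>a\<close> nor \<open>b\<close>; hence the common vertex of
          \<open>g\<close> and \<open>e\<close> is \<open>b' = b\<close>.\<close>
        have "q b' \<in> S" using b'(1) q(1) by blast
        then have "b' = b" using g(2) b' ab False S(1) sides(2) by auto
        with b'(2) show ?thesis by simp
      qed
      then show ?thesis
        using ab q(2) by (intro satisfiedI[of "{q b, b}"]) (auto simp: F_def)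
    next
      case True
      have "{a, p a} \<in> P" using True by (auto simp: P_def)
      moreover have "{a, p a} \<in> F"
        unfolding F_def by (rule image_eqI[of _ _ "p a"]) (simp_all add: True q_p p(1))
      moreover have "{a, p a} \<in> E" using True by (rule p(2))
      moreover have "{a, p a} \<inter> e \<noteq> {}" using ab(3) by simp
      moreover have "g = {a, p a}" if g: "g \<inter> e \<noteq> {}" "\<phi> g = \<phi> {a, p a}" for g
      proof -
        have "g \<in> P" using g(2) \<open>{a, p a} \<in> P\<close> unfolding \<phi>_def by (cases "g \<in> P") simp_all
        then obtain a' where a': "a' \<in> S" "g = {a', p a'}" by (auto simp: P_def)
        then have "a' = a \<or> p a' = b" using g(1) ab p(1) S(1) sides(2) by auto
        then have "a' = a" using priv[of a' a] a'(1) True e ab(3) by auto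
        with a'(2) show ?thesis by simp
      qed
      ultimately show ?thesis by (intro satisfiedI[of "{a, p a}"])
    qed
  qed
  ultimately show thesis by (intro that) blast+
qed

text \<open>A colour that makes an edge satisfied appears on \<open>F\<close>, so it is not the new colour, and
  its unique occurrence stays unique.\<close>

lemma conflict_free_of_subgraph_coloring:
  assumes "F \<subseteq> E" and "edge_coloring k F \<phi>" and "\<forall>e\<in>E. satisfied E F \<phi> e"
  shows "conflict_free (Suc k) E (\<lambda>e. if e \<in> F then \<phi> e else Suc k)"
proof -
  let ?\<psi> = "\<lambda>e. if e \<in> F then \<phi> e else Suc k"
  have range: "1 \<le> \<phi> f" "\<phi> f \<le> k" if "f \<in> F" for f
    using assms(2) that by (auto simp: edge_coloring_def)
  have "satisfied E E ?\<psi> e" if e: "e \<in> E" for e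
  proof -
    have "satisfied E F \<phi> e" using assms(3) e by (rule bspec)
    then obtain c where c: "\<exists>!f. f \<in> closed_edge_nbhd E e \<inter> F \<and> \<phi> f = c"
      unfolding satisfied_def by (rule exE)
    then obtain f where f: "f \<in> closed_edge_nbhd E e" "f \<in> F" "\<phi> f = c" by blast
    have unique: "g = f" if "g \<in> closed_edge_nbhd E e" "g \<in> F" "\<phi> g = c" for g
      using c f that by blast
    have "\<exists>!g. g \<in> closed_edge_nbhd E e \<inter> E \<and> ?\<psi> g = c"
    proof (rule ex1I[of _ f])
      show "f \<in> closed_edge_nbhd E e \<inter> E \<and> ?\<psi> f = c" using f assms(1) by auto
    next
      fix g assume "g \<in> closed_edge_nbhd E e \<inter> E \<and> ?\<psi> g = c"
      then show "g = f" using unique range(2)[OF f(2)] f(3) by (auto split: if_splits)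
    qed
    then show ?thesis unfolding satisfied_def by (rule exI)
  qed
  moreover have "edge_coloring (Suc k) E ?\<psi>"
    using range by (auto simp: edge_coloring_def le_Suc_eq)
  ultimately show ?thesis unfolding conflict_free_def by blast
qed

theorem theorem1p3:
  fixes V :: "'a set" and E :: "'a set set"
  assumes "simple_graph V E"
    and "bipartite V E"
    and "\<forall>v\<in>V. \<not> isolated_vertex V E v"
  shows "chi_sCF V E \<le> 2 \<and> chi_CF V E \<le> 3"
proof -
  obtain F \<phi> where F: "F \<subseteq> E" "edge_coloring 2 F \<phi>" "\<forall>e\<in>E. satisfied E F \<phi> e"
    using bipartite_two_colorable_subgraph[OF assms] .
  have "subgraph V F V E"
    using F(1) simple_graph_edge_subset[OF assms(1)] by (simp add: subgraph_def)
  then have "chi_sCF V E \<le> 2"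
    unfolding chi_sCF_def using F by (intro Least_le) blast
  moreover have "chi_CF V E \<le> 3"
    unfolding chi_CF_def
    using conflict_free_of_subgraph_coloring[OF F] by (intro Least_le) (auto simp: numeral_3_eq_3)
  ultimately show ?thesis ..
qed

end
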